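(* Let $\mathcal Y,\mathcal Z$ be Banach spaces, let $\mathsf A\in\mathcal L(\mathcal Y,\mathcal Y^\star)$, $\mathsf B\in\mathcal L(\mathcal Z,\mathcal Y^\star)$, $\mathsf C\in\mathcal L(\mathcal Y,\mathcal Z^\star)$, $\mathsf D\in\mathcal L(\mathcal Z,\mathcal Z^\star)$, and let $\widehat{\mathsf K}:\mathcal Y\times\mathcal Z\to\mathcal Y^\star\times\mathcal Z^\star$ be the block operator $$\widehat{\mathsf K}(y,z):=(\mathsf Ay+\mathsf Bz,\ \mathsf Cy+\mathsf Dz).$$ Let $\mathcal X$ be a Banach space and suppose that $\mathsf K:\mathcal X\to\mathcal X^\star$ is congruent to $\widehat{\mathsf K}$, in the sense that there exists an isomorphism $J:\mathcal Y\times\mathcal Z\to\mathcal X$ with $$\widehat{\mathsf K}=\Phi^{-1}J^\star\mathsf KJ,$$ where $\Phi:\mathcal Y^\star\times\mathcal Z^\star\to(\mathcal Y\times\mathcal Z)^\star$ is the canonical identification. If $\mathsf A$ is an isomorphism, then the Schur complement $\mathsf S:=\mathsf D-\mathsf C\mathsf A^{-1}\mathsf B:\mathcal Z\to\mathcal Z^\star$ satisfies: (a) $\mathsf S$ is Fredholm if and only if $\mathsf K$ is Fredholm, and $\operatorname{ind}(\mathsf S)=\operatorname{ind}(\mathsf K)$. (b) The map $\Theta:\ker(\mathsf S)\to\ker(\mathsf K)$, $\Theta(z):=J(-\mathsf A^{-1}\mathsf Bz,\ z)$, is an isomorphism. In particular, $\dim\ker(\mathsf K)=\dim\ker(\mathsf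 S)$. (c) $\mathsf K$ is an isomorphism if and only if $\mathsf S$ is an isomorphism.
   Context: $\mathcal L(Y,Z)$ denotes bounded linear operators, $Z^\star$ the dual space, $T^\star$ the Banach-space adjoint; an isomorphism is a bounded linear bijection with bounded inverse. The canonical identification is $\langle\Phi(\ell_1,\ell_2),(y,z)\rangle=\ell_1(y)+\ell_2(z)$. A bounded operator is Fredholm if its kernel is finite-dimensional and its range is closed with finite codimension; $\operatorname{ind}=\dim\ker-\operatorname{codim}\operatorname{ran}$ (the index equality in (a) is asserted when the operators are Fredholm). *)

theory Defs
  imports "HOL-Analysis.Analysis"
begin

section \<open>Duals, adjoints and isomorphisms\<close>

text \<open>
  Banach spaces are over the reals, and bounded linear operators are elements of the type
  \<open>'a \<Rightarrow>\<^sub>L 'b\<close>.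
\<close>

type_synonym 'a dual = "'a \<Rightarrow>\<^sub>L real"

definition isomorphism :: "('a::real_normed_vector \<Rightarrow>\<^sub>L 'b::real_normed_vector) \<Rightarrow> bool" where
  "isomorphism T \<longleftrightarrow> bij (blinfun_apply T) \<and> bounded_linear (inv (blinfun_apply T))"

text \<open>Only meaningful for isomorphisms; see \<open>blinfun_inverse_apply\<close>.\<close>

definition blinfun_inverse ::
    "('a::real_normed_vector \<Rightarrow>\<^sub>L 'b::real_normed_vector) \<Rightarrow> 'b \<Rightarrow>\<^sub>L 'a" where
  "blinfun_inverse T = Blinfun (inv (blinfun_apply T))"

lemma blinfun_inverse_apply:
  "isomorphism T \<Longrightarrow> blinfun_apply (blinfun_inverse T) = inv (blinfun_apply T)"
  by (simp add: isomorphism_def blinfun_inverse_def bounded_linear_Blinfun_apply)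

definition banach_adjoint ::
    "('a::real_normed_vector \<Rightarrow>\<^sub>L 'b::real_normed_vector) \<Rightarrow> 'b dual \<Rightarrow>\<^sub>L 'a dual" where
  "banach_adjoint T = Blinfun (\<lambda>l. l o\<^sub>L T)"

lemma banach_adjoint_apply [simp]: "blinfun_apply (banach_adjoint T) l = l o\<^sub>L T"
  unfolding banach_adjoint_def
  by (subst bounded_linear_Blinfun_apply)
     (auto intro: bounded_bilinear.bounded_linear_left[OF bounded_bilinear_blinfun_compose])

text \<open>The canonical identification \<open>\<Phi>(l\<^sub>1, l\<^sub>2)(y, z) = l\<^sub>1 y + l\<^sub>2 z\<close>.\<close>

definition prod_dual ::
    "('y::real_normed_vector dual \<times> 'z::real_normed_vector dual) \<Rightarrow>\<^sub>L ('y \<times> 'z) dual" where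
  "prod_dual = Blinfun (\<lambda>(l1, l2). Blinfun (\<lambda>(y, z). blinfun_apply l1 y + blinfun_apply l2 z))"

lemma prod_dual_eq:
  "(\<lambda>(l1, l2). Blinfun (\<lambda>(y, z). blinfun_apply l1 y + blinfun_apply l2 z))
     = (\<lambda>l. (fst l o\<^sub>L fst_blinfun) + (snd l o\<^sub>L snd_blinfun))"
proof (rule ext)
  fix l :: "('a \<Rightarrow>\<^sub>L 'b) \<times> ('c \<Rightarrow>\<^sub>L 'b)"
  have "(\<lambda>(y, z). blinfun_apply (fst l) y + blinfun_apply (snd l) z)
      = blinfun_apply ((fst l o\<^sub>L fst_blinfun) + (snd l o\<^sub>L snd_blinfun))"
    by (auto simp: fun_eq_iff blinfun.add_left)
  then show "(case l of (l1, l2) \<Rightarrow> Blinfun (\<lambda>(y, z). blinfun_apply l1 y + blinfun_apply l2 z))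
      = (fst l o\<^sub>L fst_blinfun) + (snd l o\<^sub>L snd_blinfun)"
    by (simp add: split_beta blinfun_apply_inverse)
qed

lemma prod_dual_apply [simp]:
  "blinfun_apply (blinfun_apply prod_dual (l1, l2)) (y, z) = blinfun_apply l1 y + blinfun_apply l2 z"
proof -
  have "bounded_linear (\<lambda>l :: 'a dual \<times> 'b dual.
          (fst l o\<^sub>L fst_blinfun) + (snd l o\<^sub>L snd_blinfun))"
    by (intro bounded_linear_add
          bounded_linear_compose[OF bounded_bilinear.bounded_linear_left[OF bounded_bilinear_blinfun_compose]]
          bounded_linear_fst bounded_linear_snd)
  then show ?thesis
    unfolding prod_dual_def prod_dual_eq
    by (simp add: bounded_linear_Blinfun_apply blinfun.add_left)
qed

lemma isomorphism_prod_dual: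
  "isomorphism (prod_dual :: ('y::real_normed_vector dual \<times> 'z::real_normed_vector dual)
     \<Rightarrow>\<^sub>L ('y \<times> 'z) dual)"
proof -
  let ?P = "blinfun_apply (prod_dual :: ('y dual \<times> 'z dual) \<Rightarrow>\<^sub>L ('y \<times> 'z) dual)"
  define i1 :: "'y \<Rightarrow>\<^sub>L ('y \<times> 'z)" where "i1 = Blinfun (\<lambda>y. (y, 0))"
  define i2 :: "'z \<Rightarrow>\<^sub>L ('y \<times> 'z)" where "i2 = Blinfun (\<lambda>z. (0, z))"
  have i1: "blinfun_apply i1 y = (y, 0)" for y
    unfolding i1_def
    by (subst bounded_linear_Blinfun_apply)
       (auto intro: bounded_linear_Pair bounded_linear_ident bounded_linear_zero)
  have i2: "blinfun_apply i2 z = (0, z)" for z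
    unfolding i2_def
    by (subst bounded_linear_Blinfun_apply)
       (auto intro: bounded_linear_Pair bounded_linear_ident bounded_linear_zero)
  define G where "G = (\<lambda>l :: ('y \<times> 'z) dual. (l o\<^sub>L i1, l o\<^sub>L i2))"
  have GP: "G (?P p) = p" for p
    by (cases p) (auto simp: G_def intro!: blinfun_eqI simp: i1 i2 blinfun.zero_right)
  have PG: "?P (G l) = l" for l
  proof (rule blinfun_eqI)
    fix x :: "'y \<times> 'z"
    obtain y z where x: "x = (y, z)" by (cases x)
    have "blinfun_apply l (y, 0) + blinfun_apply l (0, z) = blinfun_apply l (y, z)"
      by (simp flip: blinfun.add_right)
    then show "blinfun_apply (?P (G l)) x = blinfun_apply l x"
      by (simp add: G_def x i1 i2)
  qed
  have "bij ?P" using GP PG by (metis bijI')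
  moreover have "inv ?P = G"
    using GP PG by (metis inv_equality ext)
  moreover have "bounded_linear G"
    unfolding G_def
    by (intro bounded_linear_Pair bounded_bilinear.bounded_linear_left[OF bounded_bilinear_blinfun_compose])
  ultimately show ?thesis by (simp add: isomorphism_def)
qed


section \<open>Isomorphisms between subspaces\<close>

text \<open>
  Kernels are sets, not types, so isomorphisms between them are expressed relative to carrier
  subspaces; on \<open>UNIV\<close> the notions below reduce to \<open>bounded_linear\<close> and \<open>isomorphism\<close>.
\<close>

definition bounded_linear_on ::
    "'a::real_normed_vector set \<Rightarrow> ('a \<Rightarrow> 'b::real_normed_vector) \<Rightarrow> bool" where
  "bounded_linear_on U f \<longleftrightarrow>
     (\<forall>x\<in>U. \<forall>y\<in>U. f (x + y) = f x + f y) \<and>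
     (\<forall>c. \<forall>x\<in>U. f (c *\<^sub>R x) = c *\<^sub>R f x) \<and>
     (\<exists>M. \<forall>x\<in>U. norm (f x) \<le> norm x * M)"

definition isomorphism_on ::
    "'a::real_normed_vector set \<Rightarrow> 'b::real_normed_vector set \<Rightarrow> ('a \<Rightarrow> 'b) \<Rightarrow> bool" where
  "isomorphism_on U V f \<longleftrightarrow>
     bounded_linear_on U f \<and> bij_betw f U V \<and> bounded_linear_on V (inv_into U f)"

lemma bounded_linear_on_UNIV: "bounded_linear_on UNIV f \<longleftrightarrow> bounded_linear f"
  by (auto simp: bounded_linear_on_def bounded_linear_def bounded_linear_axioms_def linear_iff)

lemma isomorphism_on_UNIV: "isomorphism_on UNIV UNIV (blinfun_apply T) \<longleftrightarrow> isomorphism T"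
  by (auto simp: isomorphism_on_def isomorphism_def bounded_linear_on_UNIV
        blinfun.bounded_linear_right)


section \<open>Fredholm operators\<close>

definition finite_dim :: "'a::real_vector set \<Rightarrow> bool" where
  "finite_dim S \<longleftrightarrow> (\<exists>B. finite B \<and> S \<subseteq> span B)"

definition complementary :: "'a::real_vector set \<Rightarrow> 'a set \<Rightarrow> bool" where
  "complementary R W \<longleftrightarrow> subspace W \<and> R \<inter> W = {0} \<and> (\<forall>x. \<exists>r\<in>R. \<exists>w\<in>W. x = r + w)"

definition finite_codim :: "'a::real_vector set \<Rightarrow> bool" where
  "finite_codim R \<longleftrightarrow> (\<exists>W. complementary R W \<and> finite_dim W)"

text \<open>
  The codimension of \<open>R\<close> is the dimension of an algebraic complement. By \<open>codim_eq\<close> the choice of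
  complement is immaterial when \<open>R\<close> has finite codimension, the only case of interest here.
\<close>

definition codim :: "'a::real_vector set \<Rightarrow> nat" where
  "codim R = dim (SOME W. complementary R W)"

lemma complementary_dim_le:
  assumes R: "subspace R" and 1: "complementary R W1" and 2: "complementary R W2"
    and fin: "finite_dim W2"
  shows "finite_dim W1 \<and> dim W1 \<le> dim W2"
proof -
  have sW1: "subspace W1" and sW2: "subspace W2"
    using 1 2 by (auto simp: complementary_def)
  have ex1: "\<exists>!w. w \<in> W2 \<and> x - w \<in> R" for x
  proof -
    obtain r w where rw: "r \<in> R" "w \<in> W2" "x = r + w"
      using 2 unfolding complementary_def by blast
    show ?thesis
    proof (rule ex1I[of _ w])
      show "w \<in> W2 \<and> x - w \<in> R" using rw by simp
      fix v assume v: "v \<in> W2 \<and> x - v \<in> R"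
      have vw: "v - w \<in> W2" using v rw sW2 by (simp add: subspace_diff)
      have "r - (x - v) \<in> R" using v rw(1) R by (blast intro: subspace_diff)
      then have "v - w \<in> R" using rw(3) by simp
      with vw have "v - w \<in> R \<inter> W2" by blast
      moreover have "R \<inter> W2 = {0}" using 2 by (simp add: complementary_def)
      ultimately have "v - w = 0" by blast
      then show "v = w" by simp
    qed
  qed
  define p where "p x = (THE w. w \<in> W2 \<and> x - w \<in> R)" for x
  have p: "p x \<in> W2" "x - p x \<in> R" for x
    using theI'[OF ex1[of x]] by (auto simp: p_def)
  have p_eq: "p x = w" if "w \<in> W2" "x - w \<in> R" for x w
    using ex1[of x] p[of x] that by blast
  have lin: "linear p"
  proof (rule linearI)
    fix x y
    have "(x - p x) + (y - p y) \<in> R" using p R by (blast intro: subspace_add)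
    then have "x + y - (p x + p y) \<in> R" by (simp add: algebra_simps)
    then show "p (x + y) = p x + p y" using p_eq p sW2 by (simp add: subspace_add)
  next
    fix c x
    have "c *\<^sub>R (x - p x) \<in> R" using p R by (blast intro: subspace_scale)
    then have "c *\<^sub>R x - c *\<^sub>R p x \<in> R" by (simp add: algebra_simps)
    then show "p (c *\<^sub>R x) = c *\<^sub>R p x" using p_eq p sW2 by (simp add: subspace_scale)
  qed
  have inj: "inj_on p W1"
    unfolding linear_inj_on_iff_eq_0[OF lin sW1]
  proof (intro ballI impI)
    fix x assume x: "x \<in> W1" "p x = 0"
    then have "x \<in> R \<inter> W1" using p(2)[of x] by simp
    moreover have "R \<inter> W1 = {0}" using 1 by (simp add: complementary_def)
    ultimately show "x = 0" by blast
  qed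
  obtain B where B: "B \<subseteq> W1" "independent B" "W1 \<subseteq> span B" "card B = dim W1"
    using basis_exists[of W1] by metis
  obtain C where C: "C \<subseteq> W2" "independent C" "W2 \<subseteq> span C" "card C = dim W2"
    using basis_exists[of W2] by metis
  obtain F where F: "finite F" "W2 \<subseteq> span F" using fin by (auto simp: finite_dim_def)
  have finC: "finite C"
    using independent_span_bound[OF F(1) C(2)] C(1) F(2) by blast
  have "span B \<subseteq> W1" using B(1) sW1 by (simp add: span_minimal)
  then have injB: "inj_on p (span B)" using inj by (rule inj_on_subset[rotated])
  have ind: "independent (p ` B)"
    by (rule linear_independent_injective_image[OF lin B(2) injB])
  have sub: "p ` B \<subseteq> span C" using p(1) C(3) by blast
  have "finite (p ` B) \<and> card (p ` B) \<le> card C"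
    by (rule independent_span_bound[OF finC ind sub])
  moreover have injB': "inj_on p B" using inj B(1) by (rule inj_on_subset)
  ultimately have "finite B" "card B \<le> card C"
    by (auto simp: card_image dest: finite_imageD)
  then show ?thesis using B C by (auto simp: finite_dim_def)
qed

lemma codim_eq:
  assumes "subspace R" "complementary R W" "finite_dim W"
  shows "codim R = dim W"
proof -
  have "complementary R (SOME W. complementary R W)" using assms(2) by (rule someI)
  then show ?thesis
    unfolding codim_def using complementary_dim_le assms by (metis order_antisym)
qed

definition ker :: "('a::real_normed_vector \<Rightarrow>\<^sub>L 'b::real_normed_vector) \<Rightarrow> 'a set" where
  "ker T = {x. blinfun_apply T x = 0}"

definition fredholm :: "('a::real_normed_vector \<Rightarrow>\<^sub>L 'b::real_normed_vector) \<Rightarrow> bool" where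
  "fredholm T \<longleftrightarrow> finite_dim (ker T) \<and> closed (range (blinfun_apply T))
     \<and> finite_codim (range (blinfun_apply T))"

definition fredholm_index :: "('a::real_normed_vector \<Rightarrow>\<^sub>L 'b::real_normed_vector) \<Rightarrow> int" where
  "fredholm_index T = int (dim (ker T)) - int (codim (range (blinfun_apply T)))"


section \<open>Block operators, congruence and the Schur complement\<close>

definition block_operator ::
    "('y::real_normed_vector \<Rightarrow>\<^sub>L 'y dual) \<Rightarrow> ('z::real_normed_vector \<Rightarrow>\<^sub>L 'y dual) \<Rightarrow>
     ('y \<Rightarrow>\<^sub>L 'z dual) \<Rightarrow> ('z \<Rightarrow>\<^sub>L 'z dual) \<Rightarrow> ('y \<times> 'z) \<Rightarrow>\<^sub>L ('y dual \<times> 'z dual)" where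
  "block_operator A B C D =
     Blinfun (\<lambda>(y, z). (blinfun_apply A y + blinfun_apply B z, blinfun_apply C y + blinfun_apply D z))"

lemma block_operator_apply [simp]:
  "blinfun_apply (block_operator A B C D) (y, z) =
     (blinfun_apply A y + blinfun_apply B z, blinfun_apply C y + blinfun_apply D z)"
proof -
  have "bounded_linear (\<lambda>p. (blinfun_apply A (fst p) + blinfun_apply B (snd p),
                              blinfun_apply C (fst p) + blinfun_apply D (snd p)))"
    by (intro bounded_linear_Pair bounded_linear_add
          bounded_linear_compose[OF blinfun.bounded_linear_right]
          bounded_linear_fst bounded_linear_snd)
  then show ?thesis
    unfolding block_operator_def split_beta
    by (simp add: bounded_linear_Blinfun_apply)
qed

definition congruent_via ::
    "(('y::real_normed_vector \<times> 'z::real_normed_vector) \<Rightarrow>\<^sub>L 'x::real_normed_vector) \<Rightarrow>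
     ('x \<Rightarrow>\<^sub>L 'x dual) \<Rightarrow> (('y \<times> 'z) \<Rightarrow>\<^sub>L ('y dual \<times> 'z dual)) \<Rightarrow> bool" where
  "congruent_via J K Khat \<longleftrightarrow> isomorphism J \<and>
     Khat = blinfun_inverse prod_dual o\<^sub>L banach_adjoint J o\<^sub>L K o\<^sub>L J"

definition schur_complement ::
    "('y::real_normed_vector \<Rightarrow>\<^sub>L 'y dual) \<Rightarrow> ('z::real_normed_vector \<Rightarrow>\<^sub>L 'y dual) \<Rightarrow>
     ('y \<Rightarrow>\<^sub>L 'z dual) \<Rightarrow> ('z \<Rightarrow>\<^sub>L 'z dual) \<Rightarrow> 'z \<Rightarrow>\<^sub>L 'z dual" where
  "schur_complement A B C D = D - (C o\<^sub>L blinfun_inverse A o\<^sub>L B)"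

end

(*
  Block elimination with respect to the invertible entry A factors the block operator through
  A \<oplus> S; absorbing A and the congruence into the coordinates gives K (P (f, z)) = Q (f, S z) with
  linear homeomorphisms P and Q.  Kernel, range, complements and inverses of K are then those of
  the operator (f, z) \<mapsto> (f, S z), hence those of S.
*)
theory Submission
  imports Defs
begin

section \<open>Linear images, bounded inverses and subspaces\<close>

lemma dim_linear_image_eq:
  fixes f :: "'a::real_vector \<Rightarrow> 'b::real_vector"
  assumes f: "linear f" and inj: "inj f"
  shows "dim (f ` V) = dim V"
proof -
  obtain B where B: "B \<subseteq> V" "independent B" "V \<subseteq> span B" "card B = dim V"
    using basis_exists[of V] by metis
  have "independent (f ` B)"
    using f inj B(2) by (metis inj_on_subset linear_independent_injective_image subset_UNIV)
  moreover have "f ` V \<subseteq> span (f ` B)"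
    using B(3) f by (simp add: linear_span_image image_mono)
  ultimately have "dim (f ` V) = card (f ` B)"
    using B(1) by (intro dim_unique[of "f ` B"]) auto
  also have "\<dots> = card B"
    using inj by (metis card_image inj_on_subset subset_UNIV)
  finally show ?thesis using B(4) by simp
qed

lemma finite_dim_linear_image:
  assumes "linear f" and "finite_dim V"
  shows "finite_dim (f ` V)"
proof -
  obtain B where "finite B" "V \<subseteq> span B"
    using assms(2) by (auto simp: finite_dim_def)
  then have "finite (f ` B)" "f ` V \<subseteq> span (f ` B)"
    using assms(1) by (auto simp: linear_span_image)
  then show ?thesis unfolding finite_dim_def by blast
qed

text \<open>On \<open>V\<close> the globally bounded left inverse \<open>g\<close> coincides with
  \<open>inv_into U f\<close>. Closure of \<open>V\<close> under sums and multiples keeps this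
  agreement valid in the linearity conditions.\<close>

lemma isomorphism_onI:
  assumes f: "bounded_linear f" and g: "bounded_linear g"
    and gf: "\<And>x. g (f x) = x" and img: "f ` U = V" and V: "subspace V"
  shows "isomorphism_on U V f"
proof -
  have bl: "bounded_linear_on W h" if "bounded_linear h" for W h
    using that bounded_linear.bounded[OF that]
    by (auto simp: bounded_linear_on_def linear_simps)
  have inj: "inj_on f U" using gf by (metis inj_onI)
  have inv: "inv_into U f v = g v" if "v \<in> V" for v
    using that img gf inj by (metis f_inv_into_f)
  have "bounded_linear_on V (inv_into U f)"
    using bl[OF g, of V] V
    by (auto simp: bounded_linear_on_def inv subspace_add subspace_scale)
  then show ?thesis
    using bl[OF f] inj img by (simp add: isomorphism_on_def bij_betw_def)
qed

lemma isomorphismI: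
  fixes T :: "'a::real_normed_vector \<Rightarrow>\<^sub>L 'b::real_normed_vector"
  assumes "bounded_linear g" "\<And>x. g (T x) = x" "\<And>y. T (g y) = y"
  shows "isomorphism T"
proof -
  have "bij T" using assms by (metis bijI')
  moreover have "inv T = g" using assms by (metis inv_equality ext)
  ultimately show ?thesis using assms(1) by (simp add: isomorphism_def)
qed

lemma isomorphism_inverse:
  fixes T :: "'a::real_normed_vector \<Rightarrow>\<^sub>L 'b::real_normed_vector"
  assumes "isomorphism T"
  shows "blinfun_inverse T (T x) = x" "T (blinfun_inverse T y) = y"
  using assms
  by (simp_all add: blinfun_inverse_apply isomorphism_def bij_is_inj bij_is_surj surj_f_inv_f)

lemma subspace_ker: "subspace (ker T)"
  by (auto simp: subspace_def ker_def blinfun.add_right blinfun.scaleR_right)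

lemma subspace_range_blinfun: "subspace (range (blinfun_apply T))"
  by (metis blinfun.bounded_linear_right bounded_linear.linear linear_subspace_image subspace_UNIV)

section \<open>Operators that agree up to an identity summand\<close>

text \<open>In the coordinates given by \<open>P\<close> and \<open>Q\<close>, \<open>T\<close> is
  the direct sum of the identity of \<open>'f\<close> and \<open>S\<close>. The inverses
  \<open>P'\<close> and \<open>Q'\<close> are parameters, so every map built from them is explicit
  and visibly bounded. For the Schur complement, \<open>'f\<close> is the dual of
  \<open>'y\<close>.\<close>

locale stable_equivalence =
  fixes S :: "'z::real_normed_vector \<Rightarrow>\<^sub>L 'w::real_normed_vector"
    and T :: "'x::real_normed_vector \<Rightarrow>\<^sub>L 'v::real_normed_vector"
    and P :: "'f::real_normed_vector \<times> 'z \<Rightarrow> 'x" and P'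
    and Q :: "'f \<times> 'w \<Rightarrow> 'v" and Q'
  assumes P: "bounded_linear P" and P': "bounded_linear P'"
    and Q: "bounded_linear Q" and Q': "bounded_linear Q'"
    and P'P: "P' (P p) = p" and PP': "P (P' x) = x"
    and Q'Q: "Q' (Q q) = q" and QQ': "Q (Q' v) = v"
    and T_P: "T (P (f, z)) = Q (f, S z)"
begin

lemma T_eq: "T x = Q (fst (P' x), S (snd (P' x)))"
  using T_P[of "fst (P' x)" "snd (P' x)"] by (simp add: PP')

lemma P0: "bounded_linear (\<lambda>z. P (0, z))"
  by (intro bounded_linear_compose[OF P] bounded_linear_Pair bounded_linear_zero
      bounded_linear_ident)

lemma Q0: "bounded_linear (\<lambda>w. Q (0, w))"
  by (intro bounded_linear_compose[OF Q] bounded_linear_Pair bounded_linear_zero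
      bounded_linear_ident)

lemma snd_P': "bounded_linear (\<lambda>x. snd (P' x))"
  by (intro bounded_linear_compose[OF bounded_linear_snd] P')

lemma snd_Q': "bounded_linear (\<lambda>v. snd (Q' v))"
  by (intro bounded_linear_compose[OF bounded_linear_snd] Q')

section \<open>Kernels\<close>

lemma Q_eq_0_iff: "Q q = 0 \<longleftrightarrow> q = 0"
  by (metis Q Q'Q linear_simps(3))

text \<open>Since \<open>Q\<close> is injective, \<open>T (P (f, z)) = 0\<close> forces
  \<open>f = 0\<close> and \<open>S z = 0\<close>.\<close>

lemma ker_eq: "ker T = (\<lambda>z. P (0, z)) ` ker S"
proof (intro equalityI subsetI)
  fix x assume "x \<in> ker T"
  then have "fst (P' x) = 0" "S (snd (P' x)) = 0"
    by (simp_all add: ker_def T_eq Q_eq_0_iff zero_prod_def)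
  then show "x \<in> (\<lambda>z. P (0, z)) ` ker S"
    by (intro image_eqI[of _ _ "snd (P' x)"]) (simp_all add: ker_def, metis PP' prod.collapse)
next
  fix x assume "x \<in> (\<lambda>z. P (0, z)) ` ker S"
  then show "x \<in> ker T"
    by (auto simp: ker_def T_P Q_eq_0_iff zero_prod_def)
qed

text \<open>The bounded left inverse is the second coordinate of \<open>P'\<close>.\<close>

lemma isomorphism_on_ker: "isomorphism_on (ker S) (ker T) (\<lambda>z. P (0, z))"
  by (rule isomorphism_onI[OF P0 snd_P']) (simp_all add: P'P ker_eq[symmetric] subspace_ker)

lemma dim_ker: "dim (ker T) = dim (ker S)"
  unfolding ker_eq
  by (rule dim_linear_image_eq[OF bounded_linear.linear[OF P0]])
    (metis (mono_tags) P'P injI snd_conv)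

lemma finite_dim_ker: "finite_dim (ker T) \<longleftrightarrow> finite_dim (ker S)"
proof
  have "ker S = (\<lambda>x. snd (P' x)) ` ker T"
    by (simp add: ker_eq image_image P'P)
  then show "finite_dim (ker T) \<Longrightarrow> finite_dim (ker S)"
    by (metis bounded_linear.linear[OF snd_P'] finite_dim_linear_image)
  show "finite_dim (ker S) \<Longrightarrow> finite_dim (ker T)"
    unfolding ker_eq by (rule finite_dim_linear_image[OF bounded_linear.linear[OF P0]])
qed

section \<open>Ranges and their complements\<close>

text \<open>The identity summand can hit any \<open>f\<close>, so only the second coordinate
  restricts membership in the range.\<close>

lemma Q_in_range_iff: "Q (f, w) \<in> range T \<longleftrightarrow> w \<in> range S"
proof
  assume "Q (f, w) \<in> range T"
  then obtain x where "Q (f, w) = Q (fst (P' x), S (snd (P' x)))" by (auto simp: T_eq)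
  then have "w = S (snd (P' x))" by (metis Q'Q snd_conv)
  then show "w \<in> range S" by blast
next
  assume "w \<in> range S"
  then obtain z where "w = S z" by blast
  then have "Q (f, w) = T (P (f, z))" by (simp add: T_P)
  then show "Q (f, w) \<in> range T" by blast
qed

lemma in_range_iff: "v \<in> range T \<longleftrightarrow> snd (Q' v) \<in> range S"
  using Q_in_range_iff[of "fst (Q' v)" "snd (Q' v)"] by (simp add: QQ')

text \<open>Each range is the preimage of the other under a continuous map, namely
  \<open>w \<mapsto> Q (0, w)\<close> and \<open>v \<mapsto> snd (Q' v)\<close>.\<close>

lemma closed_range: "closed (range T) \<longleftrightarrow> closed (range S)"
proof
  have "range S = (\<lambda>w. Q (0, w)) -` range T" by (intro set_eqI) (simp only: vimage_eq Q_in_range_iff)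
  moreover have "continuous_on UNIV (\<lambda>w. Q (0, w))"
    by (rule linear_continuous_on[OF Q0])
  ultimately show "closed (range T) \<Longrightarrow> closed (range S)" by (metis closed_vimage)
  have "range T = (\<lambda>v. snd (Q' v)) -` range S" by (intro set_eqI) (simp only: vimage_eq in_range_iff)
  moreover have "continuous_on UNIV (\<lambda>v. snd (Q' v))"
    by (rule linear_continuous_on[OF snd_Q'])
  ultimately show "closed (range S) \<Longrightarrow> closed (range T)" by (metis closed_vimage)
qed

text \<open>In coordinates the range of \<open>T\<close> is the whole of \<open>'f\<close> times the
  range of \<open>S\<close>, so a complement needs only a second component.\<close>

lemma complementary_range_T:
  assumes W: "complementary (range S) W"
  shows "complementary (range T) ((\<lambda>w. Q (0, w)) ` W)"
  unfolding complementary_def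
proof (intro conjI allI)
  have sW: "subspace W" and int: "range S \<inter> W = {0}"
    and dec: "\<And>w. \<exists>r\<in>range S. \<exists>w'\<in>W. w = r + w'"
    using W unfolding complementary_def by blast+
  show "subspace ((\<lambda>w. Q (0, w)) ` W)"
    by (rule linear_subspace_image[OF bounded_linear.linear[OF Q0] sW])
  have Q00: "Q (0, 0) = 0" by (simp add: Q_eq_0_iff zero_prod_def)
  have W_range: "w = 0" if "w \<in> W" "Q (0, w) \<in> range T" for w
    using that int Q_in_range_iff by blast
  have zero: "x = 0" if x: "x \<in> range T \<inter> (\<lambda>w. Q (0, w)) ` W" for x
  proof -
    obtain w where "w \<in> W" "x = Q (0, w)" using x by blast
    then show "x = 0" using x W_range[of w] Q00 by simp
  qed
  have "0 \<in> range T" "0 \<in> W"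
    using subspace_0[OF subspace_range_blinfun] subspace_0[OF sW] by auto
  then show "range T \<inter> (\<lambda>w. Q (0, w)) ` W = {0}"
    using zero Q00 by (intro set_eqI iffI) (auto intro: rev_image_eqI)
  fix v
  obtain r w where rw: "r \<in> range S" "w \<in> W" "snd (Q' v) = r + w"
    using dec by blast
  \<comment> \<open>The whole first coordinate is assigned to the range part, which is allowed
    because \<open>Q (f, r)\<close> lies in \<open>range T\<close> for every
    \<open>f\<close>.\<close>
  have "v = Q ((fst (Q' v), r) + (0, w))"
    using rw(3) by (simp add: QQ' flip: rw(3))
  then have "v = Q (fst (Q' v), r) + Q (0, w)"
    unfolding linear_simps(1)[OF Q] .
  then show "\<exists>r\<in>range T. \<exists>w\<in>(\<lambda>w. Q (0, w)) ` W. v = r + w"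
    using rw Q_in_range_iff by blast
qed

text \<open>A complement of \<open>range T\<close> may be tilted towards the first factor, so it is
  projected to the second. Nothing is lost, because the kernel of the projection
  \<open>v \<mapsto> snd (Q' v)\<close> lies in \<open>range T\<close>.\<close>

lemma complementary_range_S:
  assumes W: "complementary (range T) W"
  shows "complementary (range S) ((\<lambda>v. snd (Q' v)) ` W)"
  unfolding complementary_def
proof (intro conjI allI)
  have sW: "subspace W" and int: "range T \<inter> W = {0}"
    and dec: "\<And>v. \<exists>r\<in>range T. \<exists>w\<in>W. v = r + w"
    using W unfolding complementary_def by blast+
  show "subspace ((\<lambda>v. snd (Q' v)) ` W)"
    by (rule linear_subspace_image[OF bounded_linear.linear[OF snd_Q'] sW])
  have Q'0: "snd (Q' 0) = 0" using snd_Q' by (rule linear_simps(3))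
  \<comment> \<open>A vector of \<open>W\<close> whose projection falls into \<open>range S\<close>
    is itself in \<open>range T\<close>, hence in the trivial intersection.\<close>
  have W_range: "w = 0" if "w \<in> W" "snd (Q' w) \<in> range S" for w
    using that int in_range_iff by blast
  have zero: "x = 0" if x: "x \<in> range S \<inter> (\<lambda>v. snd (Q' v)) ` W" for x
  proof -
    obtain v where "v \<in> W" "x = snd (Q' v)" using x by blast
    then show "x = 0" using x W_range[of v] Q'0 by simp
  qed
  have "0 \<in> range S" "0 \<in> W"
    using subspace_0[OF subspace_range_blinfun] subspace_0[OF sW] by auto
  then show "range S \<inter> (\<lambda>v. snd (Q' v)) ` W = {0}"
    using zero Q'0 by (intro set_eqI iffI) (auto intro: rev_image_eqI)
  fix u
  \<comment> \<open>Lift \<open>u\<close> to \<open>Q (0, u)\<close>, decompose there, and project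
    back.\<close>
  obtain r w where rw: "r \<in> range T" "w \<in> W" "Q (0, u) = r + w"
    using dec by blast
  have "u = snd (Q' (Q (0, u)))" by (simp add: Q'Q)
  also have "\<dots> = snd (Q' r) + snd (Q' w)"
    unfolding rw(3) using snd_Q' by (rule linear_simps(1))
  finally show "\<exists>r\<in>range S. \<exists>w\<in>(\<lambda>v. snd (Q' v)) ` W. u = r + w"
    using rw in_range_iff by blast
qed

lemma finite_codim_range: "finite_codim (range T) \<longleftrightarrow> finite_codim (range S)"
  unfolding finite_codim_def
  by (meson complementary_range_S complementary_range_T finite_dim_linear_image
      bounded_linear.linear[OF Q0] bounded_linear.linear[OF snd_Q'])

text \<open>\<open>codim\<close> picks an arbitrary complement. Finite codimension allows it to be
  computed from a chosen \<open>W\<close> and from the injective image of \<open>W\<close>.\<close>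

lemma codim_range:
  assumes "finite_codim (range S)"
  shows "codim (range T) = codim (range S)"
proof -
  obtain W where W: "complementary (range S) W" "finite_dim W"
    using assms unfolding finite_codim_def by blast
  have "inj (\<lambda>w. Q (0, w))" by (metis (mono_tags) Q'Q injI snd_conv)
  then have "dim ((\<lambda>w. Q (0, w)) ` W) = dim W"
    by (rule dim_linear_image_eq[OF bounded_linear.linear[OF Q0]])
  moreover have "finite_dim ((\<lambda>w. Q (0, w)) ` W)"
    by (rule finite_dim_linear_image[OF bounded_linear.linear[OF Q0] W(2)])
  ultimately show ?thesis
    using codim_eq[OF subspace_range_blinfun W] complementary_range_T[OF W(1)]
    by (simp add: codim_eq[OF subspace_range_blinfun])
qed

section \<open>Transfer of the Fredholm property, the index and invertibility\<close>

lemma fredholm_iff: "fredholm T \<longleftrightarrow> fredholm S"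
  by (simp add: fredholm_def finite_dim_ker closed_range finite_codim_range)

lemma fredholm_index_eq: "fredholm S \<Longrightarrow> fredholm_index T = fredholm_index S"
  by (simp add: fredholm_def fredholm_index_def dim_ker codim_range)

lemma isomorphism_iff: "isomorphism T \<longleftrightarrow> isomorphism S"
proof
  assume T: "isomorphism T"
  \<comment> \<open>The inverse of \<open>S\<close> is the lower right block of the inverse of
    \<open>T\<close> in coordinates.\<close>
  let ?g = "\<lambda>w. snd (P' (blinfun_inverse T (Q (0, w))))"
  show "isomorphism S"
  proof (rule isomorphismI)
    show "bounded_linear ?g"
      by (intro bounded_linear_compose[OF snd_P'] bounded_linear_compose[OF _ Q0]
          blinfun.bounded_linear_right)
    show "?g (S z) = z" for z
      by (simp add: T_P[symmetric] isomorphism_inverse[OF T] P'P)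
    show "S (?g w) = w" for w
      \<comment> \<open>Here \<open>T_eq\<close> expresses \<open>Q (0, w)\<close> as
        \<open>Q\<close> of a pair with second entry \<open>S (?g w)\<close>; applying
        \<open>Q'\<close> compares second entries.\<close>
      using T_eq[of "blinfun_inverse T (Q (0, w))"]
      by (simp add: isomorphism_inverse[OF T]) (metis Q'Q snd_conv)
  qed
next
  assume S: "isomorphism S"
  \<comment> \<open>In coordinates this is the identity plus the inverse of
    \<open>S\<close>.\<close>
  let ?g = "\<lambda>v. P (fst (Q' v), blinfun_inverse S (snd (Q' v)))"
  show "isomorphism T"
  proof (rule isomorphismI)
    show "bounded_linear ?g"
      by (intro bounded_linear_compose[OF P] bounded_linear_Pair
          bounded_linear_compose[OF bounded_linear_fst Q']
          bounded_linear_compose[OF blinfun.bounded_linear_right snd_Q'])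
    show "?g (T x) = x" for x
      by (simp add: T_eq Q'Q isomorphism_inverse[OF S] PP')
    show "T (?g v) = v" for v
      by (simp add: T_P isomorphism_inverse[OF S] QQ')
  qed
qed

end

section \<open>Block elimination for the congruent operator\<close>

text \<open>Take the first output \<open>f = A y + B z\<close> as a coordinate in place of
  \<open>y\<close>. Then \<open>y = A' (f - B z)\<close>, which gives \<open>P\<close>, and the
  second output \<open>C y + D z\<close> becomes \<open>C (A' f)\<close> plus the Schur complement
  applied to \<open>z\<close>. Hence \<open>Q\<close> is the triangular shift by
  \<open>C (A' f)\<close>, followed by the canonical identification and by composition with
  \<open>J'\<close>, which inverts \<open>banach_adjoint J\<close>.\<close>

lemma schur_stable_equivalence:
  fixes A :: "'y::real_normed_vector \<Rightarrow>\<^sub>L 'y dual"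
    and B :: "'z::real_normed_vector \<Rightarrow>\<^sub>L 'y dual"
    and K :: "'x::real_normed_vector \<Rightarrow>\<^sub>L 'x dual"
  assumes cong: "congruent_via J K (block_operator A B C D)" and A: "isomorphism A"
  defines "A' \<equiv> blinfun_inverse A" and "J' \<equiv> blinfun_inverse J"
    and "\<Phi>' \<equiv> blinfun_inverse prod_dual"
  shows "stable_equivalence (schur_complement A B C D) K
    (\<lambda>p. J (A' (fst p - B (snd p)), snd p))
    (\<lambda>x. (A (fst (J' x)) + B (snd (J' x)), snd (J' x)))
    (\<lambda>q. prod_dual (fst q, C (A' (fst q)) + snd q) o\<^sub>L J')
    (\<lambda>l. (fst (\<Phi>' (l o\<^sub>L J)), snd (\<Phi>' (l o\<^sub>L J)) - C (A' (fst (\<Phi>' (l o\<^sub>L J))))))"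
proof -
  have J: "isomorphism J"
    and M: "block_operator A B C D = \<Phi>' o\<^sub>L banach_adjoint J o\<^sub>L K o\<^sub>L J"
    using cong by (simp_all add: congruent_via_def \<Phi>'_def)
  have prod_dual: "isomorphism (prod_dual :: ('y dual \<times> 'z dual) \<Rightarrow>\<^sub>L ('y \<times> 'z) dual)"
    by (rule isomorphism_prod_dual)
  note inv_simps [simp] = isomorphism_inverse[OF A, folded A'_def]
    isomorphism_inverse[OF J, folded J'_def]
    isomorphism_inverse[OF prod_dual, folded \<Phi>'_def]
  have J'J: "l o\<^sub>L J' o\<^sub>L J = l" for l :: "('y \<times> 'z) dual"
    by (rule blinfun_eqI) simp
  have JJ': "l o\<^sub>L J o\<^sub>L J' = l" for l :: "'x dual"
    by (rule blinfun_eqI) simp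
  have compJ: "bounded_linear (\<lambda>l :: 'x dual. l o\<^sub>L J)"
    and compJ': "bounded_linear (\<lambda>l :: ('y \<times> 'z) dual. l o\<^sub>L J')"
    by (rule bounded_bilinear.bounded_linear_left[OF bounded_bilinear_blinfun_compose])+
  have \<Phi>'J: "bounded_linear (\<lambda>l. \<Phi>' (l o\<^sub>L J))"
    by (rule bounded_linear_compose[OF blinfun.bounded_linear_right compJ])
  have K_J: "K (J (y, z)) = prod_dual (A y + B z, C y + D z) o\<^sub>L J'" for y z
  proof -
    \<comment> \<open>Applying \<open>prod_dual\<close> to the congruence cancels
      \<open>\<Phi>'\<close>; composing with \<open>J'\<close> then isolates
      \<open>K (J (y, z))\<close>.\<close>
    have "prod_dual (block_operator A B C D (y, z)) = K (J (y, z)) o\<^sub>L J"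
      unfolding M by simp
    then show ?thesis by (metis JJ' block_operator_apply)
  qed
  note bl = bounded_linear_compose[OF blinfun.bounded_linear_right] bounded_linear_Pair
    bounded_linear_add bounded_linear_sub bounded_linear_fst bounded_linear_snd
    blinfun.bounded_linear_right
    bounded_linear_compose[OF bounded_linear_fst] bounded_linear_compose[OF bounded_linear_snd]
  show ?thesis
  proof (rule stable_equivalence.intro)
    show "bounded_linear (\<lambda>p. J (A' (fst p - B (snd p)), snd p))"
      by (intro bl)
    show "bounded_linear (\<lambda>x. (A (fst (J' x)) + B (snd (J' x)), snd (J' x)))"
      by (intro bl)
    show "bounded_linear (\<lambda>q. prod_dual (fst q, C (A' (fst q)) + snd q) o\<^sub>L J')"
      by (intro bounded_linear_compose[OF compJ'] bl)
    show "bounded_linear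
      (\<lambda>l. (fst (\<Phi>' (l o\<^sub>L J)), snd (\<Phi>' (l o\<^sub>L J)) - C (A' (fst (\<Phi>' (l o\<^sub>L J))))))"
      by (intro bl \<Phi>'J)
    show "K (J (A' (fst (f, z) - B (snd (f, z))), snd (f, z))) =
      prod_dual (fst (f, schur_complement A B C D z),
        C (A' (fst (f, schur_complement A B C D z))) + snd (f, schur_complement A B C D z)) o\<^sub>L J'"
      for f z
      by (simp add: K_J schur_complement_def blinfun.diff_left blinfun.diff_right
          A'_def[symmetric] algebra_simps)
  qed (simp_all add: J'J JJ')
qed

text \<open>As \<open>dim\<close> is 0 in infinite dimension, equality of the kernel dimensions is
  accompanied by the equivalence of their finiteness.\<close>

theorem propositionA4:
  fixes A :: "'y::banach \<Rightarrow>\<^sub>L 'y dual"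
    and B :: "'z::banach \<Rightarrow>\<^sub>L 'y dual"
    and C :: "'y \<Rightarrow>\<^sub>L 'z dual"
    and D :: "'z \<Rightarrow>\<^sub>L 'z dual"
    and K :: "'x::banach \<Rightarrow>\<^sub>L 'x dual"
    and J :: "('y \<times> 'z) \<Rightarrow>\<^sub>L 'x"
    and S :: "'z \<Rightarrow>\<^sub>L 'z dual"
  assumes "congruent_via J K (block_operator A B C D)"
    and "isomorphism A"
    and "S = schur_complement A B C D"
  shows "((fredholm S \<longleftrightarrow> fredholm K) \<and>
           (fredholm K \<longrightarrow> fredholm_index S = fredholm_index K)) \<and>
         (isomorphism_on (ker S) (ker K)
            (\<lambda>z. blinfun_apply J (- blinfun_apply (blinfun_inverse A) (blinfun_apply B z), z)) \<and>
           (finite_dim (ker K) \<longleftrightarrow> finite_dim (ker S)) \<and> dim (ker K) = dim (ker S)) \<and>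
         (isomorphism K \<longleftrightarrow> isomorphism S)"
proof -
  interpret stable_equivalence S K
    "\<lambda>p. J (blinfun_inverse A (fst p - B (snd p)), snd p)"
    "\<lambda>x. (A (fst (blinfun_inverse J x)) + B (snd (blinfun_inverse J x)), snd (blinfun_inverse J x))"
    "\<lambda>q. prod_dual (fst q, C (blinfun_inverse A (fst q)) + snd q) o\<^sub>L blinfun_inverse J"
    "\<lambda>l. (fst (blinfun_inverse prod_dual (l o\<^sub>L J)), snd (blinfun_inverse prod_dual (l o\<^sub>L J))
      - C (blinfun_inverse A (fst (blinfun_inverse prod_dual (l o\<^sub>L J)))))"
    unfolding assms(3) by (rule schur_stable_equivalence[OF assms(1,2)])
  \<comment> \<open>At \<open>f = 0\<close> the first entry passed to \<open>J\<close> is the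
    inverse of \<open>A\<close> applied to \<open>0 - B z\<close>, so
    \<open>z \<mapsto> P (0, z)\<close> is the map \<Theta>.\<close>
  show ?thesis
    using fredholm_iff fredholm_index_eq isomorphism_on_ker finite_dim_ker dim_ker isomorphism_iff
    by (simp add: blinfun.minus_right)
qed

end
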